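(* Let $K$ be a field, $m\geq 1$ and $d\geq 1$. Let $\phi:\mathbb{N}_1\to\mathbb{N}_1$ be the function $\phi(n)=3^{n}d$, and define $\gamma_{m,d}:\mathbb{N}\to\mathbb{N}$ by $$\gamma_{m,d}(i)=\left(3^{\mathcal{B}(m,\phi)-1}-1\right)d+i\quad\text{for } i\in\mathbb{N}.$$ Then for any $g\in K[x_1,\dots,x_m]$ and any $f_1,\dots,f_s\in K[x_1,\dots,x_m]$ such that $\deg(f_i)\leq d$ for $i=1,\dots,s$, the following condition is satisfied: $g\in\langle f_1,\dots,f_s\rangle$ if and only if there exist $h_1,\dots,h_s\in K[x_1,\dots,x_m]$ such that $g=h_1f_1+\dots+h_sf_s$ and $\deg(h_i)\leq\gamma_{m,d}(\deg(g))$ for $i=1,\dots,s$.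
   Context: $\mathbb{N}=\{0,1,2,\dots\}$ and $\mathbb{N}_1=\mathbb{N}\setminus\{0\}$. The degree of a polynomial is its total degree, with the convention $\deg(0)=0$. Definition of $\mathcal{B}$. Let $\mathbb{F}$ be the set of all non-decreasing functions $\mathbb{N}_1\to\mathbb{N}_1$. For $f\in\mathbb{F}$ and $s\in\mathbb{N}$ let ${}^{s}f\in\mathbb{F}$ be given by ${}^{s}f(n)=f(s+n)$. The function $\mathcal{B}:\mathbb{N}_1\times\mathbb{F}\to\mathbb{N}$ is defined by recursion on $m$. Put $\mathcal{B}(1,f)=f(1)+1$. For $m\geq 2$, assuming that $\mathcal{B}(m-1,\cdot)$ is defined, define functions $\mathcal{B}_m^k:\mathbb{F}\times\mathbb{N}^k\to\mathbb{N}$ for $k=m,m-1,\dots,0$ by backward recursion on $k$: (i) $\mathcal{B}_m^m(f,b_1,\dots,b_m)=(b_1+1)\cdots(b_m+1)$; (ii) for $0\leq k\leq m-1$, $f\in\mathbb{F}$ and $\beta\in\mathbb{N}^k$, let $g:\mathbb{N}_1\to\mathbb{N}_1$ be given by $g(1)=1$ and $g(n+1)=1+g(n)+\mathcal{B}_m^{k+1}\big({}^{g(n)}f,\beta,f(g(n))\big)$ for $n\geq 1$ (so $g\in\mathbb{F}$), and put $\mathcal{B}_m^k(f,\beta)=g\big(\mathcal{B}(m-1,f\circ g)+1\big)$. Finally, $\mathcal{B}(m,f)=\mathcal{B}_m^0(f)$ (for $k=0$ the tuple $\beta$ is empty). Note that $\mathcal{B}(m,f)\geq 1$ always. *)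

theory Defs
  imports "HOL-Algebra.Ideal" "HOL-Library.Poly_Mapping"
begin

section \<open>The function B\<close>

text \<open>
  Functions from the positive integers to themselves are modelled by functions of type
  \<open>nat \<Rightarrow> nat\<close> whose value at \<open>0\<close> is never used. The operations are defined
  on all such functions; they are meant for those that are non-decreasing and positive on
  the positive integers.
\<close>

definition shift :: "nat \<Rightarrow> (nat \<Rightarrow> nat) \<Rightarrow> nat \<Rightarrow> nat"
  where "shift s f n = f (s + n)"

text \<open>
  The sequence \<open>g\<close> with \<open>g 1 = 1\<close> and \<open>g (n + 1) = 1 + g n + c (g n)\<close>
  for \<open>n \<ge> 1\<close>. The value \<open>g 0 = 0\<close> is junk.
\<close>

fun gseq :: "(nat \<Rightarrow> nat) \<Rightarrow> nat \<Rightarrow> nat"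
  where
    "gseq c 0 = 0"
  | "gseq c (Suc 0) = 1"
  | "gseq c (Suc (Suc n)) = 1 + gseq c (Suc n) + c (gseq c (Suc n))"

text \<open>
  \<open>Bstep B' m k f \<beta>\<close> is the auxiliary function with lower index \<open>m\<close> and upper
  index \<open>k\<close>, where \<open>B'\<close> stands for \<open>\<B>(m - 1, \<cdot>)\<close> and the tuple
  \<open>\<beta>\<close> is a list of length \<open>k\<close>. The recursion runs backwards from \<open>k = m\<close>.
\<close>

function Bstep ::
    "((nat \<Rightarrow> nat) \<Rightarrow> nat) \<Rightarrow> nat \<Rightarrow> nat \<Rightarrow> (nat \<Rightarrow> nat) \<Rightarrow> nat list \<Rightarrow> nat"
  where
    "Bstep B' m k f \<beta> =
      (if k < m then
         (let g = gseq (\<lambda>s. Bstep B' m (k + 1) (shift s f) (\<beta> @ [f s]))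
          in g (B' (f \<circ> g) + 1))
       else (\<Prod>b\<leftarrow>\<beta>. b + 1))"
  by pat_completeness auto
termination
  by (relation "Wellfounded.measure (\<lambda>(B', m, k, f, \<beta>). m - k)") auto

declare Bstep.simps [simp del]

text \<open>The value for \<open>m = 0\<close> is junk.\<close>

primrec \<B> :: "nat \<Rightarrow> (nat \<Rightarrow> nat) \<Rightarrow> nat"
  where
    "\<B> 0 = (\<lambda>f. 0)"
  | "\<B> (Suc m) = (\<lambda>f. if m = 0 then f 1 + 1 else Bstep (\<B> m) (Suc m) 0 f [])"

definition \<phi> :: "nat \<Rightarrow> nat \<Rightarrow> nat"
  where "\<phi> d n = 3 ^ n * d"

text \<open>No truncation occurs in the subtractions, as \<open>\<B>(m, \<phi>) \<ge> 1\<close> for \<open>m \<ge> 1\<close>.\<close>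

definition \<gamma> :: "nat \<Rightarrow> nat \<Rightarrow> nat \<Rightarrow> nat"
  where "\<gamma> m d i = (3 ^ (\<B> m (\<phi> d) - 1) - 1) * d + i"


section \<open>Polynomials in m variables\<close>

text \<open>
  Polynomials in countably many variables \<open>x\<^sub>0, x\<^sub>1, \<dots>\<close> are finitely supported maps from
  exponent vectors to coefficients, with the convolution product of Poly_Mapping. The ring
  of polynomials in \<open>x\<^sub>1, \<dots>, x\<^sub>m\<close> consists of those in which no other variable occurs.
\<close>

type_synonym 'a mpoly = "(nat \<Rightarrow>\<^sub>0 nat) \<Rightarrow>\<^sub>0 'a"

definition mpoly_ring :: "nat \<Rightarrow> 'a::field mpoly ring"
  where "mpoly_ring m =
    \<lparr>carrier = {p. \<forall>\<alpha>\<in>Poly_Mapping.keys p. Poly_Mapping.keys \<alpha> \<subseteq> {1..m}},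
     monoid.mult = (*), one = 1, zero = 0, add = (+)\<rparr>"

definition total_degree :: "'a::zero mpoly \<Rightarrow> nat"
  where "total_degree p =
    (if p = 0 then 0
     else Max ((\<lambda>\<alpha>. \<Sum>i\<in>Poly_Mapping.keys \<alpha>. Poly_Mapping.lookup \<alpha> i)
             ` Poly_Mapping.keys p))"

end

theory Submission
  imports Defs
begin

text \<open>
  A sequence of monomials in which no entry divides a later one, the \<open>n\<close>-th entry having
  degree at most \<open>f n\<close>, has length at most \<open>\<B> m f\<close>: fix bounds for some coordinates;
  either a further coordinate stays bounded on a long block, or it can be made to increase along
  a subsequence, and deleting that coordinate leaves a bad sequence in one variable less.

  With respect to a graded monomial order, Buchberger's criterion only involves combinations of
  degree at most twice the degree of the generators. As long as some such combination has a leading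
  monomial that is not divisible by the leading monomial of a generator, adjoin it. After \<open>n\<close>
  steps the generators have degree at most \<open>3 ^ n * d\<close> and cofactors with respect to the
  original generators of degree at most \<open>(3 ^ n - 1) * d\<close>. The leading monomials of the adjoined
  elements, preceded by that of one original generator, form a bad sequence, so there are at most
  \<open>\<B> m (\<phi> d) - 1\<close> steps. Division by the resulting Groebner basis does not raise degrees.
\<close>

section \<open>Bad sequences\<close>

text \<open>The entries of the sequence are \<open>x 1, \<dots>, x L\<close>; the value \<open>x 0\<close> plays no role.\<close>

definition bad_seq :: "'c set \<Rightarrow> (nat \<Rightarrow> 'c \<Rightarrow> nat) \<Rightarrow> nat \<Rightarrow> bool"
  where "bad_seq S x L \<longleftrightarrow> (\<forall>i j. 1 \<le> i \<longrightarrow> i < j \<longrightarrow> j \<le> L \<longrightarrow> (\<exists>c\<in>S. x j c < x i c))"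

lemma bad_seqD:
  "bad_seq S x L \<Longrightarrow> 1 \<le> i \<Longrightarrow> i < j \<Longrightarrow> j \<le> L \<Longrightarrow> \<exists>c\<in>S. x j c < x i c"
  by (simp add: bad_seq_def)

lemma gseq_Suc: "n \<ge> 1 \<Longrightarrow> gseq c (Suc n) = 1 + gseq c n + c (gseq c n)"
  by (cases n) auto

lemma gseq_pos: "n \<ge> 1 \<Longrightarrow> gseq c n \<ge> 1"
  by (induction c n rule: gseq.induct) auto

lemma gseq_mono:
  assumes "1 \<le> i" "i \<le> j" shows "gseq c i \<le> gseq c j"
  using assms(2)
proof (induction j rule: dec_induct)
  case (step j)
  then show ?case using assms(1) gseq_Suc[of j c] by simp
qed simp

section \<open>Counting tuples below given bounds\<close>

lemma card_list_all2_le: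
  "finite {xs. list_all2 (\<le>) xs (\<beta>::nat list)} \<and>
    card {xs. list_all2 (\<le>) xs \<beta>} = (\<Prod>b\<leftarrow>\<beta>. b + 1)"
proof (induction \<beta>)
  case (Cons b \<beta>)
  have eq: "{xs. list_all2 (\<le>) xs (b # \<beta>)} =
      (\<lambda>(a, xs). a # xs) ` ({..b} \<times> {xs. list_all2 (\<le>) xs \<beta>})"
    by (auto simp: list_all2_Cons2)
  have "inj_on (\<lambda>(a, xs). a # xs) ({..b} \<times> {xs. list_all2 (\<le>) xs \<beta>})"
    by (auto simp: inj_on_def)
  then show ?case
    unfolding eq using Cons by (simp add: card_image card_cartesian_product)
qed simp

text \<open>If two entries agreed on all of \<open>cs\<close>, no coordinate would drop between
  them. So restriction to \<open>cs\<close> is injective into the box below \<beta>. This is the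
  bottom level of the recursion in \<open>Bstep\<close>, where every coordinate has a constant
  bound.\<close>

lemma bad_seq_bounded_length:
  assumes bad: "bad_seq (set cs) x L" and len: "length \<beta> = length cs"
    and bound: "\<And>i j. i \<in> {1..L} \<Longrightarrow> j < length cs \<Longrightarrow> x i (cs ! j) \<le> \<beta> ! j"
  shows "L \<le> (\<Prod>b\<leftarrow>\<beta>. b + 1)"
proof -
  have inj: "inj_on (\<lambda>i. map (x i) cs) {1..L}"
  proof (rule linorder_inj_onI)
    fix i j assume "i < j" "i \<in> {1..L}" "j \<in> {1..L}"
    then show "map (x i) cs \<noteq> map (x j) cs"
      using bad_seqD[OF bad, of i j] by force
  qed auto
  have "(\<lambda>i. map (x i) cs) ` {1..L} \<subseteq> {xs. list_all2 (\<le>) xs \<beta>}"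
    using len bound by (auto simp: list_all2_conv_all_nth)
  then show ?thesis
    using card_inj_on_le[OF inj, of "{xs. list_all2 (\<le>) xs \<beta>}"] card_list_all2_le[of \<beta>]
    by simp
qed

text \<open>Here \<open>cs\<close> lists the coordinates that already have constant bounds \<beta>,
  so its length is the upper index of \<open>Bstep\<close>, and \<open>B'\<close> handles one
  coordinate less. The induction is on the number of coordinates outside \<open>cs\<close>;
  \<open>f\<close> and \<open>x\<close> vary because passing to a block of the sequence shifts
  both.\<close>

lemma Bstep_bound:
  fixes S :: "'c set"
  assumes B': "\<And>(S :: 'c set) f x L. finite S \<Longrightarrow> card S = m \<Longrightarrow> mono_on {1..} f \<Longrightarrow>
      (\<And>i c. i \<in> {1..L} \<Longrightarrow> c \<in> S \<Longrightarrow> x i c \<le> f i) \<Longrightarrow> bad_seq S x L \<Longrightarrow> L \<le> B' f"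
    and S: "finite S" "card S = Suc m" and cs: "distinct cs" "set cs \<subseteq> S"
    and len: "length \<beta> = length cs"
    and "\<And>i j. i \<in> {1..L} \<Longrightarrow> j < length cs \<Longrightarrow> x i (cs ! j) \<le> \<beta> ! j"
    and "mono_on {1..} f"
    and "\<And>i c. i \<in> {1..L} \<Longrightarrow> c \<in> S \<Longrightarrow> x i c \<le> f i" and "bad_seq S x L"
  shows "L \<le> Bstep B' (Suc m) (length cs) f \<beta>"
  using cs len assms(7-)
proof (induction "Suc m - length cs" arbitrary: cs \<beta> f x L rule: less_induct)
  case less
  note bnd = less.prems(4) and mono = less.prems(5) and deg = less.prems(6)
    and bad = less.prems(7)
  show ?case
  proof (cases "length cs < Suc m")
    case False
    then have "set cs = S"
      using less.prems(1,2) S by (metis card_seteq distinct_card not_less)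
    moreover from this have "L \<le> (\<Prod>b\<leftarrow>\<beta>. b + 1)"
      using bad_seq_bounded_length[of cs x L \<beta>] bad bnd less.prems(3) by simp
    ultimately show ?thesis
      using False by (simp add: Bstep.simps)
  next
    case True
    then obtain a where a: "a \<in> S" "a \<notin> set cs"
      using S less.prems(1,2) by (metis distinct_card nat_neq_iff subsetI subset_antisym)
    define c where "c = (\<lambda>s. Bstep B' (Suc m) (length cs + 1) (shift s f) (\<beta> @ [f s]))"
    define g where "g = gseq c"
    define N where "N = B' (f \<circ> g)"
    have B_eq: "Bstep B' (Suc m) (length cs) f \<beta> = g (N + 1)"
      using True by (subst Bstep.simps) (simp add: g_def c_def N_def Let_def)
    note f_mono = mono_onD[OF mono]
    \<comment> \<open>Otherwise the block after position \<open>g n\<close> is a bad sequence with one more bounded coordinate,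
      and longer than \<open>c (g n)\<close>.\<close>
    have ex: "\<exists>q. g n < q \<and> q \<le> g (Suc n) \<and> f (g n) < x q a"
      if n: "n \<ge> 1" and L: "g (Suc n) \<le> L" for n
    proof (rule ccontr)
      assume neg: "\<not> ?thesis"
      define M where "M = Suc (c (g n))"
      have gS: "g (Suc n) = g n + M"
        using gseq_Suc[OF n, of c] by (simp add: g_def M_def)
      have "M \<le> Bstep B' (Suc m) (length (cs @ [a])) (shift (g n) f) (\<beta> @ [f (g n)])"
      proof (rule less.hyps[where x = "\<lambda>i. x (g n + i)"])
        show "Suc m - length (cs @ [a]) < Suc m - length cs" using True by simp
        show "distinct (cs @ [a])" "set (cs @ [a]) \<subseteq> S"
          "length (\<beta> @ [f (g n)]) = length (cs @ [a])"
          using a less.prems by auto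
        show "mono_on {1..} (shift (g n) f)"
          by (rule mono_onI) (auto simp: shift_def intro!: f_mono)
        show "x (g n + i) e \<le> shift (g n) f i" if "i \<in> {1..M}" "e \<in> S" for i e
          using that deg[of "g n + i" e] L gS by (auto simp: shift_def)
        show "bad_seq S (\<lambda>i. x (g n + i)) M"
          unfolding bad_seq_def using bad_seqD[OF bad, of "g n + i" "g n + j" for i j] L gS
          by auto
        fix i j assume i: "i \<in> {1..M}" and j: "j < length (cs @ [a])"
        have "x (g n + i) a \<le> f (g n)"
          using neg[unfolded not_ex, rule_format, of "g n + i"] i gS by auto
        then show "x (g n + i) ((cs @ [a]) ! j) \<le> (\<beta> @ [f (g n)]) ! j"
          using bnd[of "g n + i" j] i j L gS less.prems(3) by (auto simp: nth_append less_Suc_eq)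
      qed
      then show False by (simp add: M_def c_def)
    qed
    \<comment> \<open>If \<open>L\<close> reached \<open>g (N + 1)\<close>, the first entry and one
      witness from each of the \<open>N\<close> blocks would form a bad sequence of length
      \<open>N + 1\<close> without coordinate \<open>a\<close>, one longer than \<open>B'\<close>
      allows.\<close>
    have "L < g (N + 1)"
    proof (rule ccontr)
      assume "\<not> L < g (N + 1)"
      then have L: "g (N + 1) \<le> L" by simp
      have gL: "g n \<le> L" if "1 \<le> n" "n \<le> N + 1" for n
        using gseq_mono[OF that, of c] L by (simp add: g_def)
      obtain q where q: "\<And>n. n \<ge> 1 \<Longrightarrow> n \<le> N \<Longrightarrow>
          g n < q n \<and> q n \<le> g (Suc n) \<and> f (g n) < x (q n) a"
        using ex gL by (metis Suc_eq_plus1 Suc_le_mono le_add2)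
      \<comment> \<open>The subsequence starts with entry 1 and continues with the witness of each
        block. Its \<open>n\<close>-th pick lies no later than \<open>g n\<close>, so its
        coordinates are at most \<open>f (g n)\<close>, while every later pick exceeds
        \<open>f (g n)\<close> at \<open>a\<close>.\<close>
      define idx where "idx n = (if n = 1 then 1 else q (n - 1))" for n
      have idx_pos: "1 \<le> idx n \<and> idx n \<le> g n" if "1 \<le> n" "n \<le> N + 1" for n
      proof (cases "n = 1")
        case False
        then have "1 \<le> n - 1" "n - 1 \<le> N" using that by auto
        then show ?thesis using q[of "n - 1"] that by (auto simp: idx_def)
      qed (simp add: idx_def g_def)
      have idx_gt: "g n < idx n' \<and> f (g n) < x (idx n') a"
        if "1 \<le> n" "n < n'" "n' \<le> N + 1" for n n'
      proof -
        have "g n \<le> g (n' - 1)" "1 \<le> g n"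
          using gseq_mono[of n "n' - 1" c] gseq_pos[of n c] that by (auto simp: g_def)
        moreover from this have "f (g n) \<le> f (g (n' - 1))" by (intro f_mono) auto
        moreover have "g (n' - 1) < q (n' - 1) \<and> f (g (n' - 1)) < x (q (n' - 1)) a"
          using q[of "n' - 1"] that by auto
        ultimately show ?thesis using that by (auto simp: idx_def)
      qed
      have "N + 1 \<le> B' (f \<circ> g)"
      proof (rule B'[where S = "S - {a}" and x = "\<lambda>n. x (idx n)"])
        show "finite (S - {a})" "card (S - {a}) = m" using S a by auto
        show "mono_on {1..} (f \<circ> g)"
          by (rule mono_onI) (auto simp: g_def intro!: f_mono gseq_mono gseq_pos)
        have deg': "x (idx n) e \<le> f (g n)" if "n \<in> {1..N + 1}" "e \<in> S" for n e
        proof -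
          have "idx n \<in> {1..L}" "1 \<le> idx n" "idx n \<le> g n"
            using idx_pos[of n] gL[of n] that(1) by auto
          then show ?thesis
            using deg[of "idx n" e] f_mono[of "idx n" "g n"] that(2) by force
        qed
        then show "x (idx n) e \<le> (f \<circ> g) n" if "n \<in> {1..N + 1}" "e \<in> S - {a}" for n e
          using that by simp
        show "bad_seq (S - {a}) (\<lambda>n. x (idx n)) (N + 1)"
          unfolding bad_seq_def
        proof (intro allI impI)
          fix n n' :: nat assume n: "1 \<le> n" "n < n'" "n' \<le> N + 1"
          have "idx n < idx n'" "1 \<le> idx n" "idx n' \<le> L"
            using idx_pos[of n] idx_pos[of n'] idx_gt[OF n] gL[of n'] n by auto
          then obtain e where e: "e \<in> S" "x (idx n') e < x (idx n) e"
            using bad_seqD[OF bad] by blast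
          \<comment> \<open>Coordinate \<open>a\<close> rises, so the coordinate \<open>e\<close>
            that falls is a different one and survives the deletion of \<open>a\<close>.\<close>
          moreover have "x (idx n) a < x (idx n') a"
            using deg'[of n a] idx_gt[OF n] n a by auto
          ultimately show "\<exists>e\<in>S - {a}. x (idx n') e < x (idx n) e" by force
        qed
      qed
      then show False by (simp add: N_def)
    qed
    then show ?thesis using B_eq by simp
  qed
qed

text \<open>The coordinates form an arbitrary set because the induction deletes whichever one
  happens to rise. In the base case the sequence is a strictly decreasing one of numbers starting at
  most at \<open>f 1\<close>.\<close>

theorem bad_seq_length_le_B:
  fixes S :: "'c set"
  assumes "m \<ge> 1" "finite S" "card S = m" "mono_on {1..} f"
    and "\<And>i c. i \<in> {1..L} \<Longrightarrow> c \<in> S \<Longrightarrow> x i c \<le> f i" "bad_seq S x L"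
  shows "L \<le> \<B> m f"
  using assms
proof (induction m arbitrary: S f x L rule: dec_induct)
  case base
  then obtain a where S: "S = {a}" by (auto simp: card_1_singleton_iff)
  have dec: "x j a < x i a" if "1 \<le> i" "i < j" "j \<le> L" for i j
    using bad_seqD[OF base(5) that] S by simp
  then have "inj_on (\<lambda>i. x i a) {1..L}"
    by (intro linorder_inj_onI) (auto dest: dec[rotated])
  moreover have "(\<lambda>i. x i a) ` {1..L} \<subseteq> {..f 1}"
  proof (rule image_subsetI)
    fix i assume i: "i \<in> {1..L}"
    show "x i a \<in> {..f 1}"
      using base(4)[of 1 a] dec[of 1 i] i S by (cases "i = 1") auto
  qed
  ultimately show ?case
    using card_inj_on_le[of _ "{1..L}" "{..f 1}"] by fastforce
next
  case (step m)
  have "L \<le> Bstep (\<B> m) (Suc m) (length ([] :: 'c list)) f []"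
    by (rule Bstep_bound[where x = x and S = S, OF step.IH])
      (use step.prems in \<open>auto simp del: atLeastAtMost_iff\<close>)
  then show ?case using step.hyps by simp
qed


section \<open>Monomials and polynomials\<close>

abbreviation "keys \<equiv> Poly_Mapping.keys"
abbreviation "lookup \<equiv> Poly_Mapping.lookup"
abbreviation "single \<equiv> Poly_Mapping.single"

type_synonym mono = "nat \<Rightarrow>\<^sub>0 nat"

definition mdeg :: "mono \<Rightarrow> nat"
  where "mdeg \<alpha> = (\<Sum>i\<in>keys \<alpha>. lookup \<alpha> i)"

lemma mdeg_eq_sum: "finite K \<Longrightarrow> keys \<alpha> \<subseteq> K \<Longrightarrow> mdeg \<alpha> = (\<Sum>i\<in>K. lookup \<alpha> i)"
  unfolding mdeg_def by (rule sum.mono_neutral_left) (auto simp: in_keys_iff)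

lemma mdeg_add: "mdeg (\<alpha> + \<beta>) = mdeg \<alpha> + mdeg \<beta>"
proof -
  let ?K = "keys \<alpha> \<union> keys \<beta>"
  have "mdeg (\<alpha> + \<beta>) = (\<Sum>i\<in>?K. lookup (\<alpha> + \<beta>) i)"
    by (rule mdeg_eq_sum) (auto dest: subsetD[OF keys_add])
  also have "\<dots> = (\<Sum>i\<in>?K. lookup \<alpha> i) + (\<Sum>i\<in>?K. lookup \<beta> i)"
    by (simp add: lookup_add sum.distrib)
  also have "\<dots> = mdeg \<alpha> + mdeg \<beta>"
    by (simp add: mdeg_eq_sum[of ?K])
  finally show ?thesis .
qed

lemma keys_minus_nat: "keys (\<alpha> - \<beta> :: mono) \<subseteq> keys \<alpha>"
  by (auto simp: in_keys_iff lookup_minus)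

lemma mdeg_minus_le: "mdeg (\<alpha> - \<beta>) \<le> mdeg \<alpha>"
  using keys_minus_nat[of \<alpha> \<beta>]
  by (subst mdeg_eq_sum[of "keys \<alpha>" "\<alpha> - \<beta>"])
    (auto simp: mdeg_def lookup_minus intro!: sum_mono)

lemma lookup_le_mdeg: "lookup \<alpha> i \<le> mdeg \<alpha>"
  by (cases "i \<in> keys \<alpha>") (auto simp: mdeg_def in_keys_iff intro: member_le_sum)

text \<open>The degree-lexicographic order: ties are broken by the linear order on poly mappings,
  which respects addition. Comparing degrees first makes a bound on leading monomials a bound on
  degrees.\<close>

definition mless :: "mono \<Rightarrow> mono \<Rightarrow> bool" (infix "\<prec>" 50)
  where "\<alpha> \<prec> \<beta> \<longleftrightarrow> mdeg \<alpha> < mdeg \<beta> \<or> mdeg \<alpha> = mdeg \<beta> \<and> \<alpha> < \<beta>"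

definition mle :: "mono \<Rightarrow> mono \<Rightarrow> bool" (infix "\<preceq>" 50)
  where "\<alpha> \<preceq> \<beta> \<longleftrightarrow> \<alpha> \<prec> \<beta> \<or> \<alpha> = \<beta>"

interpretation mo: linorder mle mless
  by unfold_locales (auto simp: mle_def mless_def)

lemma mdeg_mono: "\<alpha> \<preceq> \<beta> \<Longrightarrow> mdeg \<alpha> \<le> mdeg \<beta>"
  by (auto simp: mle_def mless_def)

lemma mless_add_left: "\<alpha> \<prec> \<beta> \<Longrightarrow> \<tau> + \<alpha> \<prec> \<tau> + \<beta>"
  by (auto simp: mless_def mdeg_add)

lemma mle_add_left: "\<alpha> \<preceq> \<beta> \<Longrightarrow> \<tau> + \<alpha> \<preceq> \<tau> + \<beta>"
  by (auto simp: mle_def mless_add_left)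

section \<open>Monomials and polynomials in the variables with index 1 to m\<close>

definition monoms :: "nat \<Rightarrow> mono set"
  where "monoms m = {\<alpha>. keys \<alpha> \<subseteq> {1..m}}"

lemma monoms_0 [simp]: "0 \<in> monoms m"
  by (simp add: monoms_def)

lemma monoms_add: "\<alpha> \<in> monoms m \<Longrightarrow> \<beta> \<in> monoms m \<Longrightarrow> \<alpha> + \<beta> \<in> monoms m"
  using keys_add[of \<alpha> \<beta>] by (auto simp: monoms_def)

lemma monoms_minus: "\<alpha> \<in> monoms m \<Longrightarrow> \<alpha> - \<beta> \<in> monoms m"
  using keys_minus_nat[of \<alpha> \<beta>] by (auto simp: monoms_def)

lemma finite_monoms_mdeg_le: "finite {\<alpha> \<in> monoms m. mdeg \<alpha> \<le> n}"
proof -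
  have "inj_on lookup {\<alpha> \<in> monoms m. mdeg \<alpha> \<le> n}"
    by (simp add: inj_on_def lookup_inject)
  moreover have "lookup ` {\<alpha> \<in> monoms m. mdeg \<alpha> \<le> n} \<subseteq>
      {f. \<forall>x. (x \<in> {1..m} \<longrightarrow> f x \<in> {..n}) \<and> (x \<notin> {1..m} \<longrightarrow> f x = 0)}"
  proof (intro image_subsetI CollectI allI conjI impI)
    fix \<alpha> x assume \<alpha>: "\<alpha> \<in> {\<alpha> \<in> monoms m. mdeg \<alpha> \<le> n}"
    show "lookup \<alpha> x \<in> {..n}" using \<alpha> lookup_le_mdeg[of \<alpha> x] by auto
    show "lookup \<alpha> x = 0" if "x \<notin> {1..m}"
      using \<alpha> that by (auto simp: monoms_def in_keys_iff)
  qed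
  moreover have "finite {f. \<forall>x. (x \<in> {1..m} \<longrightarrow> f x \<in> {..n}) \<and> (x \<notin> {1..m} \<longrightarrow> f x = (0::nat))}"
    by (rule finite_set_of_finite_funs) auto
  ultimately show ?thesis by (meson finite_imageD finite_subset)
qed

text \<open>Only finitely many monomials of \<open>monoms m\<close> lie below a given one, since
  their degree is no larger. The restriction to \<open>monoms m\<close> matters: with infinitely
  many variables, the variables themselves form an infinite descending chain.\<close>

lemma monoms_less_induct [consumes 1, case_names less]:
  assumes "\<alpha> \<in> monoms m"
    and step: "\<And>\<alpha>. \<alpha> \<in> monoms m \<Longrightarrow> (\<And>\<beta>. \<beta> \<in> monoms m \<Longrightarrow> \<beta> \<prec> \<alpha> \<Longrightarrow> P \<beta>) \<Longrightarrow> P \<alpha>"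
  shows "P \<alpha>"
  using assms(1)
proof (induction "card {\<beta> \<in> monoms m. \<beta> \<prec> \<alpha>}" arbitrary: \<alpha> rule: less_induct)
  case less
  show ?case
  proof (rule step[OF less.prems])
    fix \<beta> assume \<beta>: "\<beta> \<in> monoms m" "\<beta> \<prec> \<alpha>"
    have "{\<tau> \<in> monoms m. \<tau> \<prec> \<alpha>} \<subseteq> {\<tau> \<in> monoms m. mdeg \<tau> \<le> mdeg \<alpha>}"
      by (auto simp: mless_def)
    then have "finite {\<tau> \<in> monoms m. \<tau> \<prec> \<alpha>}"
      using finite_monoms_mdeg_le by (rule finite_subset)
    then have "card {\<tau> \<in> monoms m. \<tau> \<prec> \<beta>} < card {\<tau> \<in> monoms m. \<tau> \<prec> \<alpha>}"
      by (rule psubset_card_mono) (use \<beta> in \<open>auto intro: mo.less_trans\<close>)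
    then show "P \<beta>" using less.hyps \<beta>(1) by blast
  qed
qed

definition polys :: "nat \<Rightarrow> 'a::zero mpoly set"
  where "polys m = {p. keys p \<subseteq> monoms m}"

lemma carrier_mpoly_ring: "carrier (mpoly_ring m) = polys m"
  by (auto simp: mpoly_ring_def polys_def monoms_def)

lemma polys_add: "p \<in> polys m \<Longrightarrow> q \<in> polys m \<Longrightarrow> p + q \<in> polys m"
  using keys_add[of p q] by (auto simp: polys_def)

lemma polys_uminus: "p \<in> polys m \<Longrightarrow> - p \<in> polys m" for p :: "'a::ab_group_add mpoly"
  by (auto simp: polys_def in_keys_iff)

lemma polys_mult: "p \<in> polys m \<Longrightarrow> q \<in> polys m \<Longrightarrow> p * q \<in> polys m"
  for p :: "'a::semiring_0 mpoly"
  using keys_mult[of p q] by (fastforce simp: polys_def intro: monoms_add)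

lemma polys_0_1 [simp]: "0 \<in> polys m" "(1 :: 'a::zero_neq_one mpoly) \<in> polys m"
  by (auto simp: polys_def)

lemma polys_sum: "(\<And>i. i \<in> I \<Longrightarrow> p i \<in> polys m) \<Longrightarrow> (\<Sum>i\<in>I. p i) \<in> polys m"
  by (induction I rule: infinite_finite_induct) (auto intro: polys_add)

lemma polys_single: "t \<in> monoms m \<Longrightarrow> single t c \<in> polys m"
  by (simp add: polys_def)

lemma total_degree_le_iff: "total_degree p \<le> n \<longleftrightarrow> (\<forall>\<alpha>\<in>keys p. mdeg \<alpha> \<le> n)"
proof (cases "p = 0")
  case False
  then have "keys p \<noteq> {}" by (metis poly_mapping_eqI in_keys_iff lookup_zero empty_iff)
  then show ?thesis
    using False by (simp add: total_degree_def mdeg_def[abs_def])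
qed (simp add: total_degree_def)

section \<open>Leading monomials and the Buchberger criterion\<close>

text \<open>The value at \<open>0\<close> is unspecified; this is why generating sets are later
  required to avoid \<open>0\<close>.\<close>

definition lm :: "'a::zero mpoly \<Rightarrow> mono"
  where "lm p = (THE \<alpha>. \<alpha> \<in> keys p \<and> (\<forall>\<beta>\<in>keys p. \<beta> \<preceq> \<alpha>))"

lemma lm_eqI: "\<alpha> \<in> keys p \<Longrightarrow> (\<And>\<beta>. \<beta> \<in> keys p \<Longrightarrow> \<beta> \<preceq> \<alpha>) \<Longrightarrow> lm p = \<alpha>"
  unfolding lm_def by (rule the_equality) (auto intro: mo.order.antisym)

lemma lm_props:
  assumes "p \<noteq> 0"
  shows "lm p \<in> keys p \<and> (\<forall>\<beta>\<in>keys p. \<beta> \<preceq> lm p)"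
proof -
  have "keys p \<noteq> {}" using assms by (metis poly_mapping_eqI in_keys_iff lookup_zero empty_iff)
  then obtain \<alpha> where "\<alpha> \<in> keys p" "\<forall>\<beta>\<in>keys p. \<alpha> \<preceq> \<beta> \<longrightarrow> \<alpha> = \<beta>"
    using mo.finite_has_maximal[of "keys p"] by auto
  then have "\<alpha> \<in> keys p \<and> (\<forall>\<beta>\<in>keys p. \<beta> \<preceq> \<alpha>)"
    by (metis mo.linear)
  then show ?thesis using lm_eqI[of \<alpha> p] by simp
qed

lemma lm_in_keys: "p \<noteq> 0 \<Longrightarrow> lm p \<in> keys p"
  and lm_max: "\<beta> \<in> keys p \<Longrightarrow> \<beta> \<preceq> lm p"
  using lm_props[of p] by (cases "p = 0"; auto)+

lemma lm_in_monoms: "p \<in> polys m \<Longrightarrow> p \<noteq> 0 \<Longrightarrow> lm p \<in> monoms m"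
  using lm_in_keys[of p] by (auto simp: polys_def)

lemma mdeg_lm_le: "p \<noteq> 0 \<Longrightarrow> mdeg (lm p) \<le> total_degree p"
  using lm_in_keys total_degree_le_iff by blast

lemma lm_less:
  assumes "\<And>\<beta>. \<beta> \<in> keys p \<Longrightarrow> \<beta> \<preceq> \<mu>" "lookup p \<mu> = 0" "p \<noteq> 0"
  shows "lm p \<prec> \<mu>"
  using assms lm_in_keys[of p] by (metis in_keys_iff mle_def)

section \<open>Monomial multiples and their sums\<close>

lemma lookup_single_times:
  "lookup (single t c * g) (t + \<alpha>) = c * lookup g \<alpha>" for g :: "'a::semiring_0 mpoly"
  by (simp add: lookup_mult lookup_single when_mult)

lemma keys_single_times: "keys (single t c * g) \<subseteq> (+) t ` keys g"
  for g :: "'a::semiring_0 mpoly"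
  using keys_mult[of "single t c" g] by (auto split: if_splits)

lemma single_times_single_times: "single u c * (single t c' * g) = single (u + t) (c * c') * g"
  for g :: "'a::comm_semiring_0 mpoly"
  by (simp add: mult_single flip: mult.assoc)

lemma single_add_times: "single t (c + c') * g = single t c * g + single t c' * g"
  for g :: "'a::comm_semiring_0 mpoly"
  by (simp add: single_add distrib_right)

text \<open>
  The condition \<open>Q\<close> is on the leading monomials of the summands, which may cancel in the sum.
\<close>

inductive_set mspan :: "nat \<Rightarrow> 'a::field mpoly set \<Rightarrow> (mono \<Rightarrow> bool) \<Rightarrow> 'a mpoly set"
  for m G Q where
    zero: "0 \<in> mspan m G Q"
  | add_term: "p \<in> mspan m G Q \<Longrightarrow> g \<in> G \<Longrightarrow> t \<in> monoms m \<Longrightarrow> Q (t + lm g) \<Longrightarrow>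
      p + single t c * g \<in> mspan m G Q"

lemma mspan_term:
  "g \<in> G \<Longrightarrow> t \<in> monoms m \<Longrightarrow> Q (t + lm g) \<Longrightarrow> single t c * g \<in> mspan m G Q"
  using mspan.add_term[OF mspan.zero] by force

lemma mspan_add: "q \<in> mspan m G Q \<Longrightarrow> p \<in> mspan m G Q \<Longrightarrow> p + q \<in> mspan m G Q"
  by (induction rule: mspan.induct) (auto simp flip: add.assoc intro: mspan.intros)

lemma mspan_sum: "(\<And>i. i \<in> I \<Longrightarrow> p i \<in> mspan m G Q) \<Longrightarrow> (\<Sum>i\<in>I. p i) \<in> mspan m G Q"
  by (induction I rule: infinite_finite_induct) (auto intro: mspan.zero mspan_add)

lemma mspan_mono:
  assumes "p \<in> mspan m G Q"
    and "\<And>g t. g \<in> G \<Longrightarrow> t \<in> monoms m \<Longrightarrow> Q (t + lm g) \<Longrightarrow> Q' (t + lm g)"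
  shows "p \<in> mspan m G Q'"
  using assms(1) by induction (auto intro: mspan.intros assms(2))

lemma mspan_single_times:
  assumes "p \<in> mspan m G Q" "u \<in> monoms m" "\<And>\<mu>. Q \<mu> \<Longrightarrow> Q' (u + \<mu>)"
  shows "single u c * p \<in> mspan m G Q'"
  using assms(1)
proof induction
  case (add_term p g t c')
  have "single (u + t) (c * c') * g \<in> mspan m G Q'"
    using add_term assms(2,3) by (auto intro!: mspan_term monoms_add simp: add.assoc)
  then show ?case
    using add_term by (simp add: distrib_left single_times_single_times mspan_add)
qed (simp add: mspan.zero)

lemma mspan_diff:
  assumes "p \<in> mspan m G Q" "q \<in> mspan m G Q"
  shows "p - q \<in> mspan m G Q"
proof -
  have "single 0 (- 1) * q \<in> mspan m G Q"
    using assms(2) by (rule mspan_single_times) auto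
  then have "- q \<in> mspan m G Q" by (simp add: single_uminus)
  then have "p + - q \<in> mspan m G Q" using assms(1) by (rule mspan_add)
  then show ?thesis by simp
qed

lemma mspan_keys:
  assumes "p \<in> mspan m G Q" "\<alpha> \<in> keys p"
  shows "\<exists>\<mu>. Q \<mu> \<and> \<alpha> \<preceq> \<mu>"
  using assms
proof (induction arbitrary: \<alpha>)
  case (add_term p g t c)
  then consider "\<alpha> \<in> keys p" | "\<alpha> \<in> keys (single t c * g)"
    using keys_add[of p "single t c * g"] by auto
  then show ?case
  proof cases
    case 2
    then obtain \<beta> where "\<beta> \<in> keys g" "\<alpha> = t + \<beta>" using keys_single_times by fast
    then show ?thesis using add_term.hyps lm_max mle_add_left by blast
  qed (use add_term.IH in blast)
qed simp

lemma mspan_subset_polys: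
  assumes "G \<subseteq> polys m" shows "mspan m G Q \<subseteq> polys m"
proof
  fix p assume "p \<in> mspan m G Q"
  then show "p \<in> polys m"
    by induction (use assms in \<open>auto intro!: polys_add polys_mult polys_single\<close>)
qed

text \<open>Among the finitely many leading monomials of the summands the largest one again
  satisfies \<open>Q\<close>. This turns a strict bound \<prec> \<mu> into a bound \<preceq> \<nu>
  with \<nu> \<prec> \<mu>, as the descent in Buchberger's criterion requires. The empty sum has no
  largest summand, whence the case \<open>p = 0\<close>.\<close>

lemma mspan_bounded:
  assumes "p \<in> mspan m G Q" "G \<subseteq> polys m - {0}"
  shows "p = 0 \<or> (\<exists>\<mu>\<in>monoms m. Q \<mu> \<and> p \<in> mspan m G (\<lambda>\<alpha>. \<alpha> \<preceq> \<mu>))"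
  using assms(1)
proof induction
  case (add_term p g t c)
  let ?\<nu> = "t + lm g"
  have \<nu>: "?\<nu> \<in> monoms m"
    using add_term.hyps assms(2) by (auto intro!: monoms_add lm_in_monoms)
  have tm: "single t c * g \<in> mspan m G (\<lambda>\<alpha>. \<alpha> \<preceq> ?\<nu>)"
    using add_term.hyps by (intro mspan_term) auto
  from add_term.IH show ?case
  proof (elim disjE bexE conjE)
    assume "p = 0" then show ?thesis using tm \<nu> add_term.hyps by auto
  next
    fix \<mu> assume \<mu>: "\<mu> \<in> monoms m" "Q \<mu>" "p \<in> mspan m G (\<lambda>\<alpha>. \<alpha> \<preceq> \<mu>)"
    define \<kappa> where "\<kappa> = (if \<mu> \<preceq> ?\<nu> then ?\<nu> else \<mu>)"
    have "\<mu> \<preceq> \<kappa>" "?\<nu> \<preceq> \<kappa>" "\<kappa> \<in> monoms m" "Q \<kappa>"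
      using \<mu> \<nu> add_term.hyps by (auto simp: \<kappa>_def)
    moreover have "p \<in> mspan m G (\<lambda>\<alpha>. \<alpha> \<preceq> \<kappa>)"
      using \<mu>(3) by (rule mspan_mono) (use \<open>\<mu> \<preceq> \<kappa>\<close> in \<open>blast intro: mo.order.trans\<close>)
    moreover have "single t c * g \<in> mspan m G (\<lambda>\<alpha>. \<alpha> \<preceq> \<kappa>)"
      using tm by (rule mspan_mono) (use \<open>?\<nu> \<preceq> \<kappa>\<close> in \<open>blast intro: mo.order.trans\<close>)
    ultimately show ?thesis by (blast intro: mspan_add)
  qed
qed simp

section \<open>Standard representations and S-polynomials\<close>

lemma mpoly_eq_sum_single: "p = (\<Sum>\<alpha>\<in>keys p. single \<alpha> (lookup p \<alpha>))"
proof (rule poly_mapping_eqI)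
  fix \<beta>
  show "lookup p \<beta> = lookup (\<Sum>\<alpha>\<in>keys p. single \<alpha> (lookup p \<alpha>)) \<beta>"
    by (simp add: lookup_sum lookup_single when_def in_keys_iff)
qed

lemma mspan_times:
  assumes "g \<in> G" "h \<in> polys m"
  shows "h * g \<in> mspan m G (\<lambda>_. True)"
proof -
  have "(\<Sum>\<alpha>\<in>keys h. single \<alpha> (lookup h \<alpha>)) * g \<in> mspan m G (\<lambda>_. True)"
    using assms by (auto simp: sum_distrib_right polys_def intro!: mspan_sum mspan_term)
  then show ?thesis by (simp flip: mpoly_eq_sum_single)
qed

text \<open>This is the division algorithm: cancel the leading term by a multiple of some
  \<open>g\<close>, and repeat with the remainder, whose leading monomial is smaller. The remainder
  is again a combination of degree at most \<open>e\<close>, so \<open>red\<close> keeps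
  applying.\<close>

lemma standard_representation:
  assumes G: "G \<subseteq> polys m - {0}"
    and red: "\<And>v. v \<in> mspan m G (\<lambda>\<mu>. mdeg \<mu> \<le> e) \<Longrightarrow> v \<noteq> 0 \<Longrightarrow>
      \<exists>g\<in>G. \<exists>t\<in>monoms m. lm v = t + lm g"
    and v: "v \<in> mspan m G (\<lambda>\<mu>. mdeg \<mu> \<le> e)" "v \<noteq> 0"
  shows "v \<in> mspan m G (\<lambda>\<mu>. \<mu> \<preceq> lm v)"
proof -
  have "lm v \<in> monoms m" using v G mspan_subset_polys[of G m] by (auto intro: lm_in_monoms)
  then show ?thesis
    using v
  proof (induction "lm v" arbitrary: v rule: monoms_less_induct)
    case less
    note v = less.prems
    obtain g t where g: "g \<in> G" "t \<in> monoms m" "lm v = t + lm g"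
      using red[OF v] by blast
    define c where "c = lookup v (lm v) / lookup g (lm g)"
    define w where "w = v - single t c * g"
    \<comment> \<open>The subtracted multiple has leading monomial \<open>lm v\<close>, so this
      bound keeps the remainder within the range of \<open>red\<close>.\<close>
    have "mdeg (lm v) \<le> e"
      using mspan_keys[OF v(1) lm_in_keys[OF v(2)]] mdeg_mono by fastforce
    then have w: "w \<in> mspan m G (\<lambda>\<mu>. mdeg \<mu> \<le> e)"
      unfolding w_def using v(1) g by (intro mspan_diff mspan_term) auto
    have tm: "single t c * g \<in> mspan m G (\<lambda>\<mu>. \<mu> \<preceq> lm v)"
      using g by (intro mspan_term) auto
    have "w \<in> mspan m G (\<lambda>\<mu>. \<mu> \<preceq> lm v)"
    proof (cases "w = 0")
      case False
      have lt: "lm w \<prec> lm v"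
      proof (rule lm_less[OF _ _ False])
        have "lookup g (lm g) \<noteq> 0"
          using lm_in_keys[of g] g(1) G by (auto simp: in_keys_iff)
        then show "lookup w (lm v) = 0"
          using lookup_single_times[of t c g "lm g"] g(3)
          by (simp add: w_def lookup_minus c_def)
        fix \<beta> assume "\<beta> \<in> keys w"
        then have "\<beta> \<in> keys v \<or> \<beta> \<in> keys (single t c * g)"
          by (auto simp: w_def in_keys_iff lookup_minus)
        then show "\<beta> \<preceq> lm v"
          using mspan_keys[OF tm, of \<beta>] lm_max[of \<beta> v] by (auto intro: mo.order.trans)
      qed
      moreover have "lm w \<in> monoms m"
        using w False G mspan_subset_polys[of G m] by (auto intro: lm_in_monoms)
      ultimately have "w \<in> mspan m G (\<lambda>\<mu>. \<mu> \<preceq> lm w)"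
        using less.hyps(2)[of w] w False by blast
      then show ?thesis
        by (rule mspan_mono) (use lt in \<open>auto intro: mo.order.trans\<close>)
    qed (simp add: mspan.zero)
    then have "w + single t c * g \<in> mspan m G (\<lambda>\<mu>. \<mu> \<preceq> lm v)"
      using tm by (blast intro: mspan_add)
    then show "v \<in> mspan m G (\<lambda>\<mu>. \<mu> \<preceq> lm v)" by (simp add: w_def)
  qed
qed

text \<open>The difference is a monomial multiple of the S-polynomial of \<open>g\<close> and
  \<open>g0\<close>. The S-polynomial is a combination of degree at most \<open>e\<close>, so it has
  a standard representation, and cancellation puts its leading monomial strictly below the least
  common multiple.\<close>

lemma syzygy_reduces:
  assumes G: "G \<subseteq> polys m - {0}"
    and red: "\<And>v. v \<in> mspan m G (\<lambda>\<mu>. mdeg \<mu> \<le> e) \<Longrightarrow> v \<noteq> 0 \<Longrightarrow>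
      \<exists>g\<in>G. \<exists>t\<in>monoms m. lm v = t + lm g"
    and deg: "\<And>g g'. g \<in> G \<Longrightarrow> g' \<in> G \<Longrightarrow> mdeg (lm g) + mdeg (lm g') \<le> e"
    and g: "g \<in> G" "t \<in> monoms m" "t + lm g = \<mu>"
    and g0: "g0 \<in> G" "t0 \<in> monoms m" "t0 + lm g0 = \<mu>"
  shows "single t 1 * g - single t0 (lookup g (lm g) / lookup g0 (lm g0)) * g0
    \<in> mspan m G (\<lambda>\<alpha>. \<alpha> \<prec> \<mu>)"
proof -
  define k where "k = lookup g (lm g) / lookup g0 (lm g0)"
  have lc: "lookup g0 (lm g0) \<noteq> 0" using lm_in_keys[of g0] g0(1) G by (auto simp: in_keys_iff)
  \<comment> \<open>By truncated subtraction, \<open>l\<close> is the least common multiple of the leading monomials.\<close>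
  define a b where "a = lm g0 - lm g" and "b = lm g - lm g0"
  define l where "l = a + lm g"
  \<comment> \<open>Both leading monomials divide \<mu>, hence so does \<open>l\<close>, and
    \<open>u\<close> is the cofactor with \<open>u + l = \<mu>\<close>.\<close>
  define u where "u = t - a"
  have lb: "l = b + lm g0"
    by (rule poly_mapping_eqI) (simp add: l_def a_def b_def lookup_add lookup_minus)
  have ta: "t = u + a"
  proof (rule poly_mapping_eqI)
    fix i
    have "lookup (t + lm g) i = lookup (t0 + lm g0) i" using g(3) g0(3) by simp
    then show "lookup t i = lookup (u + a) i"
      by (simp add: u_def a_def lookup_add lookup_minus)
  qed
  have ul: "u + l = \<mu>" using g(3) by (simp add: ta l_def add.assoc)
  have "t0 + lm g0 = (u + b) + lm g0" using ul g0(3) lb by (simp add: add.assoc)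
  then have tb: "t0 = u + b" by simp
  have ab: "a \<in> monoms m" "b \<in> monoms m" "u \<in> monoms m"
    using g g0 G by (auto simp: a_def b_def u_def intro!: monoms_minus lm_in_monoms)
  define S where "S = single a 1 * g - single b k * g0"
  \<comment> \<open>Both summands have leading monomial exactly \<open>l\<close>; this one fact
    yields the degree bound \<open>e\<close> as well as the bound \<open>l\<close> on all monomials
    of \<open>S\<close>.\<close>
  have S: "S \<in> mspan m G (\<lambda>\<alpha>. \<alpha> = l)"
    unfolding S_def using g g0 ab lb l_def by (intro mspan_diff mspan_term) auto
  have "mdeg l \<le> mdeg (lm g0) + mdeg (lm g)"
    using mdeg_minus_le[of "lm g0" "lm g"] by (simp add: l_def a_def mdeg_add)
  then have S': "S \<in> mspan m G (\<lambda>\<mu>. mdeg \<mu> \<le> e)"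
    using deg[OF g0(1) g(1)] by (intro mspan_mono[OF S]) auto
  have S0: "lookup S l = 0"
    using lookup_single_times[of a 1 g "lm g"] lookup_single_times[of b k g0 "lm g0"] lc
    by (simp add: S_def lookup_minus k_def flip: lb l_def)
  have "S \<in> mspan m G (\<lambda>\<alpha>. \<alpha> \<prec> l)"
  proof (cases "S = 0")
    case False
    have "lm S \<prec> l"
      by (rule lm_less[OF _ S0 False]) (use mspan_keys[OF S] in blast)
    then show ?thesis
      by (intro mspan_mono[OF standard_representation[OF G red S' False]])
        (auto intro: mo.order.strict_trans1)
  qed (simp add: mspan.zero)
  then have "single u 1 * S \<in> mspan m G (\<lambda>\<alpha>. \<alpha> \<prec> \<mu>)"
    by (rule mspan_single_times) (use ab ul mless_add_left in auto)
  also have "single u 1 * S = single t 1 * g - single t0 k * g0"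
    by (simp add: S_def right_diff_distrib single_times_single_times ta tb)
  finally show ?thesis by (simp add: k_def)
qed

text \<open>Modulo smaller summands, every summand with leading monomial \<mu> is a scalar multiple
  of \<open>single t0 1 * g0\<close> by \<open>syzygy_reduces\<close>; \<open>C\<close> collects
  these scalars.\<close>

lemma mspan_split_top:
  assumes G: "G \<subseteq> polys m - {0}"
    and red: "\<And>v. v \<in> mspan m G (\<lambda>\<mu>. mdeg \<mu> \<le> e) \<Longrightarrow> v \<noteq> 0 \<Longrightarrow>
      \<exists>g\<in>G. \<exists>t\<in>monoms m. lm v = t + lm g"
    and deg: "\<And>g g'. g \<in> G \<Longrightarrow> g' \<in> G \<Longrightarrow> mdeg (lm g) + mdeg (lm g') \<le> e"
    and g0: "g0 \<in> G" "t0 \<in> monoms m" "t0 + lm g0 = \<mu>"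
    and p: "p \<in> mspan m G (\<lambda>\<alpha>. \<alpha> \<preceq> \<mu>)"
  shows "\<exists>C. p - single t0 C * g0 \<in> mspan m G (\<lambda>\<alpha>. \<alpha> \<prec> \<mu>)"
  using p
proof induction
  case zero
  show ?case by (rule exI[of _ 0]) (simp add: mspan.zero)
next
  case (add_term p g t c)
  then obtain C where C: "p - single t0 C * g0 \<in> mspan m G (\<lambda>\<alpha>. \<alpha> \<prec> \<mu>)" by blast
  show ?case
  proof (cases "t + lm g = \<mu>")
    case False
    then have "t + lm g \<prec> \<mu>" using add_term.hyps by (simp add: mle_def)
    then have "(p - single t0 C * g0) + single t c * g \<in> mspan m G (\<lambda>\<alpha>. \<alpha> \<prec> \<mu>)"
      using C add_term.hyps by (intro mspan.add_term) auto
    then show ?thesis by (intro exI[of _ C]) (simp add: algebra_simps)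
  next
    case True
    define k where "k = lookup g (lm g) / lookup g0 (lm g0)"
    have "single t 1 * g - single t0 k * g0 \<in> mspan m G (\<lambda>\<alpha>. \<alpha> \<prec> \<mu>)"
      unfolding k_def using syzygy_reduces[OF G red deg _ _ True g0] add_term.hyps by blast
    then have "single 0 c * (single t 1 * g - single t0 k * g0) \<in> mspan m G (\<lambda>\<alpha>. \<alpha> \<prec> \<mu>)"
      by (rule mspan_single_times) auto
    then have "(p - single t0 C * g0) + single 0 c * (single t 1 * g - single t0 k * g0)
        \<in> mspan m G (\<lambda>\<alpha>. \<alpha> \<prec> \<mu>)"
      using C by (rule mspan_add)
    also have "(p - single t0 C * g0) + single 0 c * (single t 1 * g - single t0 k * g0) =
        (p + single t c * g) - single t0 (C + c * k) * g0"
      by (simp add: right_diff_distrib single_times_single_times single_add_times)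
    finally show ?thesis by blast
  qed
qed

text \<open>Descend on the bound \<mu> of a representation. Either the bound can be lowered, or all
  top summands merge into a single one with nonzero coefficient, and then \<mu> is the leading
  monomial of \<open>p\<close>. Reducibility is tested only up to degree \<open>e\<close>, whereas
  \<open>p\<close> may have any degree.\<close>

theorem buchberger_criterion:
  assumes G: "G \<subseteq> polys m - {0}"
    and red: "\<And>v. v \<in> mspan m G (\<lambda>\<mu>. mdeg \<mu> \<le> e) \<Longrightarrow> v \<noteq> 0 \<Longrightarrow>
      \<exists>g\<in>G. \<exists>t\<in>monoms m. lm v = t + lm g"
    and deg: "\<And>g g'. g \<in> G \<Longrightarrow> g' \<in> G \<Longrightarrow> mdeg (lm g) + mdeg (lm g') \<le> e"
    and p: "p \<in> mspan m G (\<lambda>_. True)" "p \<noteq> 0"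
  shows "p \<in> mspan m G (\<lambda>\<alpha>. \<alpha> \<preceq> lm p)"
proof -
  obtain \<mu> where "\<mu> \<in> monoms m" "p \<in> mspan m G (\<lambda>\<alpha>. \<alpha> \<preceq> \<mu>)"
    using mspan_bounded[OF p(1) G] p(2) by blast
  then show ?thesis
  proof (induction rule: monoms_less_induct)
    case (less \<mu>)
    show ?case
    proof (cases "p \<in> mspan m G (\<lambda>\<alpha>. \<alpha> \<prec> \<mu>)")
      case True
      then obtain \<nu> where "\<nu> \<in> monoms m" "\<nu> \<prec> \<mu>" "p \<in> mspan m G (\<lambda>\<alpha>. \<alpha> \<preceq> \<nu>)"
        using mspan_bounded[OF True G] p(2) by blast
      then show ?thesis using less.IH by blast
    next
      case False
      have "\<exists>g0\<in>G. \<exists>t0\<in>monoms m. t0 + lm g0 = \<mu>"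
      proof (rule ccontr)
        assume "\<not> ?thesis"
        then have "p \<in> mspan m G (\<lambda>\<alpha>. \<alpha> \<prec> \<mu>)"
          by (intro mspan_mono[OF less.prems]) (auto simp: mle_def)
        then show False using False by blast
      qed
      then obtain g0 t0 where g0: "g0 \<in> G" "t0 \<in> monoms m" "t0 + lm g0 = \<mu>" by blast
      obtain C where C: "p - single t0 C * g0 \<in> mspan m G (\<lambda>\<alpha>. \<alpha> \<prec> \<mu>)"
        using mspan_split_top[OF G red deg g0 less.prems] by blast
      define r where "r = p - single t0 C * g0"
      \<comment> \<open>With \<open>C = 0\<close> the polynomial \<open>p\<close> itself would have
        a representation below \<mu>, contrary to the case assumption.\<close>
      have "C \<noteq> 0" using C False by auto
      have "lookup r \<mu> = 0"
        using mspan_keys[of r m G _ \<mu>] C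
        by (metis in_keys_iff mo.leD r_def)
      moreover have "lookup g0 (lm g0) \<noteq> 0"
        using lm_in_keys[of g0] g0(1) G by (auto simp: in_keys_iff)
      ultimately have "lookup p \<mu> \<noteq> 0"
        using lookup_single_times[of t0 C g0 "lm g0"] g0(3) \<open>C \<noteq> 0\<close>
        by (auto simp: r_def lookup_minus)
      then have "lm p = \<mu>"
        using mspan_keys[OF less.prems]
        by (intro lm_eqI) (auto simp: in_keys_iff intro: mo.order.trans)
      then show ?thesis using less.prems by simp
    qed
  qed
qed


section \<open>Cofactors of bounded degree\<close>

definition combos :: "nat \<Rightarrow> nat \<Rightarrow> (nat \<Rightarrow> 'a::field mpoly) \<Rightarrow> nat \<Rightarrow> 'a mpoly set"
  where "combos m s f E = {p. \<exists>h. (\<forall>i\<in>{1..s}. h i \<in> polys m \<and> total_degree (h i) \<le> E) \<and>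
    p = (\<Sum>i=1..s. h i * f i)}"

lemma combosI:
  "(\<And>i. i \<in> {1..s} \<Longrightarrow> h i \<in> polys m \<and> total_degree (h i) \<le> E) \<Longrightarrow>
    (\<Sum>i=1..s. h i * f i) \<in> combos m s f E"
  unfolding combos_def by blast

lemma combos_zero: "0 \<in> combos m s f E"
  using combosI[of s "\<lambda>_. 0" m E f] by (simp add: total_degree_def)

lemma combos_mono: "E \<le> E' \<Longrightarrow> p \<in> combos m s f E \<Longrightarrow> p \<in> combos m s f E'"
  unfolding combos_def by (blast intro: order_trans)

lemma combos_add:
  assumes "p \<in> combos m s f E" "q \<in> combos m s f E"
  shows "p + q \<in> combos m s f E"
proof -
  obtain h h' where h: "\<And>i. i \<in> {1..s} \<Longrightarrow> h i \<in> polys m \<and> total_degree (h i) \<le> E"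
      "p = (\<Sum>i=1..s. h i * f i)"
    and h': "\<And>i. i \<in> {1..s} \<Longrightarrow> h' i \<in> polys m \<and> total_degree (h' i) \<le> E"
      "q = (\<Sum>i=1..s. h' i * f i)"
    using assms unfolding combos_def by blast
  have "(\<Sum>i=1..s. (h i + h' i) * f i) \<in> combos m s f E"
  proof (intro combosI conjI)
    fix i assume i: "i \<in> {1..s}"
    show "h i + h' i \<in> polys m" using h(1)[OF i] h'(1)[OF i] by (simp add: polys_add)
    show "total_degree (h i + h' i) \<le> E"
      using h(1)[OF i] h'(1)[OF i] keys_add[of "h i" "h' i"]
      unfolding total_degree_le_iff by blast
  qed
  then show ?thesis by (simp add: h(2) h'(2) distrib_right sum.distrib)
qed

lemma combos_single_times:
  assumes "p \<in> combos m s f E" "t \<in> monoms m"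
  shows "single t c * p \<in> combos m s f (E + mdeg t)"
proof -
  obtain h where h: "\<And>i. i \<in> {1..s} \<Longrightarrow> h i \<in> polys m \<and> total_degree (h i) \<le> E"
      "p = (\<Sum>i=1..s. h i * f i)"
    using assms unfolding combos_def by blast
  have "(\<Sum>i=1..s. (single t c * h i) * f i) \<in> combos m s f (E + mdeg t)"
  proof (intro combosI conjI)
    fix i assume i: "i \<in> {1..s}"
    show "single t c * h i \<in> polys m"
      using h(1)[OF i] assms(2) by (simp add: polys_mult polys_single)
    show "total_degree (single t c * h i) \<le> E + mdeg t"
      using h(1)[OF i] keys_single_times[of t c "h i"]
      unfolding total_degree_le_iff by (fastforce simp: mdeg_add)
  qed
  then show ?thesis by (simp add: h(2) sum_distrib_left mult.assoc)
qed

lemma generator_in_combos: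
  assumes "i \<in> {1..s}" shows "f i \<in> combos m s f E"
proof -
  have "(\<Sum>j=1..s. (if j = i then 1 else 0) * f j) \<in> combos m s f E"
    by (intro combosI) (auto simp: total_degree_le_iff mdeg_def)
  also have "(\<Sum>j=1..s. (if j = i then 1 else 0) * f j) = f i"
    using assms by (simp add: if_distrib[of "\<lambda>x. x * _"] cong: if_cong)
  finally show ?thesis .
qed

text \<open>From \<open>mdeg (t + lm g) \<le> e\<close> it follows that
  \<open>mdeg t \<le> e\<close>, so each multiplication by a term raises cofactor degrees by at most
  \<open>e\<close>.\<close>

lemma mspan_combos:
  assumes "p \<in> mspan m G (\<lambda>\<mu>. mdeg \<mu> \<le> e)" "G \<subseteq> combos m s f E"
  shows "p \<in> combos m s f (E + e)"
  using assms(1)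
proof induction
  case (add_term p g t c)
  then have "single t c * g \<in> combos m s f (E + mdeg t)"
    using assms(2) by (intro combos_single_times) auto
  then have "single t c * g \<in> combos m s f (E + e)"
    by (rule combos_mono[rotated]) (use add_term.hyps in \<open>simp add: mdeg_add\<close>)
  then show ?case using add_term.IH by (rule combos_add[rotated])
qed (rule combos_zero)

text \<open>Failure of divisibility means that some exponent drops, so the leading monomials form a
  bad sequence. The chain is indexed from 0 and bad sequences from 1: \<open>gs i\<close> sits at
  position \<open>i + 1\<close>, where its degree bound \<open>3 ^ i * d\<close> is below
  \<open>\<phi> d (i + 1)\<close>.\<close>

lemma lm_chain_length_le_B:
  fixes gs :: "nat \<Rightarrow> 'a::field mpoly"
  assumes "m \<ge> 1"
    and gs: "\<And>i. i \<le> n \<Longrightarrow> gs i \<in> polys m \<and> gs i \<noteq> 0 \<and> total_degree (gs i) \<le> 3 ^ i * d"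
    and ndvd: "\<And>i j. i < j \<Longrightarrow> j \<le> n \<Longrightarrow> \<not> (\<exists>t\<in>monoms m. lm (gs j) = t + lm (gs i))"
  shows "n + 1 \<le> \<B> m (\<phi> d)"
proof (rule bad_seq_length_le_B[where S = "{1..m}" and x = "\<lambda>i. lookup (lm (gs (i - 1)))"])
  show "mono_on {1..} (\<phi> d)" by (rule mono_onI) (simp add: \<phi>_def)
  fix i c assume i: "i \<in> {1..n + 1}"
  have "lookup (lm (gs (i - 1))) c \<le> total_degree (gs (i - 1))"
    using lookup_le_mdeg mdeg_lm_le gs[of "i - 1"] i
    by (metis add.commute atLeastAtMost_iff le_diff_conv le_trans)
  also have "\<dots> \<le> 3 ^ (i - 1) * d" using gs[of "i - 1"] i by auto
  also have "\<dots> \<le> 3 ^ i * d" by (intro mult_right_mono power_increasing) auto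
  finally show "lookup (lm (gs (i - 1))) c \<le> \<phi> d i" by (simp add: \<phi>_def)
next
  show "bad_seq {1..m} (\<lambda>i. lookup (lm (gs (i - 1)))) (n + 1)"
    unfolding bad_seq_def
  proof (intro allI impI, rule ccontr)
    fix i j :: nat assume ij: "1 \<le> i" "i < j" "j \<le> n + 1"
    let ?a = "lm (gs (i - 1))" and ?b = "lm (gs (j - 1))"
    assume neg: "\<not> (\<exists>c\<in>{1..m}. lookup ?b c < lookup ?a c)"
    have "i - 1 \<le> n" "j - 1 \<le> n" using ij by auto
    then have ab: "?a \<in> monoms m" "?b \<in> monoms m"
      using gs by (blast intro: lm_in_monoms)+
    have "lookup ?a c \<le> lookup ?b c" for c
    proof (cases "c \<in> {1..m}")
      case True
      then show ?thesis using neg by (meson not_less)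
    next
      case False
      then have "c \<notin> keys ?a" using ab(1) unfolding monoms_def by blast
      then show ?thesis by (simp add: in_keys_iff)
    qed
    then have "?b = (?b - ?a) + ?a"
      by (intro poly_mapping_eqI) (simp add: lookup_add lookup_minus)
    moreover have "?b - ?a \<in> monoms m" using ab(2) by (rule monoms_minus)
    ultimately show False using ndvd[of "i - 1" "j - 1"] ij by auto
  qed
qed (use assms(1) in auto)

text \<open>The given representation only shows that \<open>p\<close> is a combination of the
  generators. The bounded cofactors come from dividing \<open>p\<close> by a completed set
  \<open>G\<close> and substituting the known combinations for the elements of
  \<open>G\<close>.\<close>

theorem combos_effective:
  fixes f :: "nat \<Rightarrow> 'a::field mpoly"
  assumes "m \<ge> 1"
    and f: "\<And>i. i \<in> {1..s} \<Longrightarrow> f i \<in> polys m \<and> total_degree (f i) \<le> d"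
    and p: "p \<in> combos m s f E"
  shows "p \<in> combos m s f (\<gamma> m d (total_degree p))"
proof (cases "p = 0")
  case True
  then show ?thesis by (simp add: combos_zero)
next
  case False
  define F where "F = f ` {1..s} - {0}"
  obtain h where h: "\<And>i. i \<in> {1..s} \<Longrightarrow> h i \<in> polys m" "p = (\<Sum>i=1..s. h i * f i)"
    using p unfolding combos_def by blast
  have "\<exists>i\<in>{1..s}. f i \<noteq> 0"
  proof (rule ccontr)
    assume "\<not> ?thesis"
    then have "p = 0" unfolding h(2) by (intro sum.neutral) simp
    then show False using False by simp
  qed
  then obtain g0 where g0: "g0 \<in> F" by (auto simp: F_def)
  have F: "g \<in> polys m" "g \<noteq> 0" "total_degree g \<le> d" "g \<in> combos m s f E"
    if "g \<in> F" for g E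
    using that f generator_in_combos[of _ s f m] by (auto simp: F_def)
  \<comment> \<open>At \<open>i = 0\<close> the bounds are \<open>d\<close> for the degree and
    \<open>0\<close> for the cofactors, so any nonzero generator starts a chain.\<close>
  define chain where "chain n gs \<longleftrightarrow>
      (\<forall>i\<le>n. gs i \<in> polys m \<and> gs i \<noteq> 0 \<and> total_degree (gs i) \<le> 3 ^ i * d \<and>
        gs i \<in> combos m s f ((3 ^ i - 1) * d)) \<and>
      (\<forall>i j. i < j \<longrightarrow> j \<le> n \<longrightarrow> \<not> (\<exists>t\<in>monoms m. lm (gs j) = t + lm (gs i)))"
    for n and gs :: "nat \<Rightarrow> 'a mpoly"
  have chain_length: "n + 1 \<le> \<B> m (\<phi> d)" if "chain n gs" for n gs
    using that unfolding chain_def by (intro lm_chain_length_le_B[of m n gs]) (use assms(1) in auto)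
  have "chain 0 (\<lambda>_. g0)"
    using F[OF g0] by (simp add: chain_def)
  then have ex0: "\<exists>gs. chain 0 gs" by blast
  \<comment> \<open>A chain that cannot be extended has passed Buchberger's test.\<close>
  define N where "N = (GREATEST n. \<exists>gs. chain n gs)"
  have le_B: "n \<le> \<B> m (\<phi> d)" if "\<exists>gs. chain n gs" for n
    using that chain_length by fastforce
  have "\<exists>gs. chain N gs"
    unfolding N_def using GreatestI_nat[of "\<lambda>n. \<exists>gs. chain n gs", OF ex0] le_B by blast
  then obtain gs where gs: "chain N gs" by blast
  have max: "\<not> chain (Suc N) gs'" for gs'
    using Greatest_le_nat[of "\<lambda>n. \<exists>gs. chain n gs" "Suc N"] le_B
    unfolding N_def[symmetric] by (metis Suc_n_not_le_n)
  have gsD: "gs i \<in> polys m" "gs i \<noteq> 0" "total_degree (gs i) \<le> 3 ^ N * d"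
      "gs i \<in> combos m s f ((3 ^ N - 1) * d)" if "i \<le> N" for i
  proof -
    have pow: "(3::nat) ^ i \<le> 3 ^ N" using that by (intro power_increasing) auto
    have "(3 ^ i - 1) * d \<le> (3 ^ N - 1) * d"
      using pow by (intro mult_right_mono diff_le_mono) auto
    then show "gs i \<in> combos m s f ((3 ^ N - 1) * d)"
      using gs that combos_mono unfolding chain_def by blast
    have "3 ^ i * d \<le> 3 ^ N * d" using pow by (intro mult_right_mono) auto
    then show "total_degree (gs i) \<le> 3 ^ N * d"
      using gs that unfolding chain_def by (blast intro: order_trans)
  qed (use gs that in \<open>auto simp: chain_def\<close>)
  \<comment> \<open>All of \<open>F\<close> is included, so that \<open>p\<close> is a combination
    of \<open>G\<close>. A \<open>v\<close> irreducible by \<open>G\<close> is in particular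
    irreducible by every \<open>gs i\<close>, so it would extend the chain.\<close>
  define G where "G = F \<union> gs ` {..N}"
  have G: "G \<subseteq> polys m - {0}" and G_combos: "G \<subseteq> combos m s f ((3 ^ N - 1) * d)"
    using F gsD by (auto simp: G_def)
  have G_deg: "mdeg (lm g) \<le> 3 ^ N * d" if "g \<in> G" for g
  proof -
    have "d \<le> 3 ^ N * d" by simp
    then have "total_degree g \<le> 3 ^ N * d" if "g \<in> F"
      using F(3)[OF that] by (rule order_trans[rotated])
    then have "total_degree g \<le> 3 ^ N * d"
      using that gsD(3) by (auto simp: G_def)
    moreover have "g \<noteq> 0" using that G by blast
    ultimately show ?thesis using mdeg_lm_le[of g] by simp
  qed
  have red: "\<exists>g\<in>G. \<exists>t\<in>monoms m. lm v = t + lm g"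
    if v: "v \<in> mspan m G (\<lambda>\<mu>. mdeg \<mu> \<le> 2 * 3 ^ N * d)" "v \<noteq> 0" for v
  proof (rule ccontr)
    assume neg: "\<not> ?thesis"
    have "chain (Suc N) (gs(Suc N := v))"
      unfolding chain_def
    proof (intro conjI allI impI)
      have "v \<in> polys m" using v(1) G mspan_subset_polys[of G m] by auto
      moreover have "total_degree v \<le> 3 ^ Suc N * d"
        unfolding total_degree_le_iff
      proof
        fix \<alpha> assume "\<alpha> \<in> keys v"
        then obtain \<mu> where "mdeg \<mu> \<le> 2 * 3 ^ N * d" "\<alpha> \<preceq> \<mu>"
          using mspan_keys[OF v(1)] by blast
        then show "mdeg \<alpha> \<le> 3 ^ Suc N * d" using mdeg_mono by fastforce
      qed
      moreover have "v \<in> combos m s f ((3 ^ Suc N - 1) * d)"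
      proof -
        \<comment> \<open>The growth rate 3: degrees double, but cofactor degrees grow by \<open>2 * 3 ^ N * d\<close>.\<close>
        have "(1::nat) \<le> 3 ^ N" by simp
        then have "(3 ^ N - 1) + 2 * 3 ^ N = (3 ^ Suc N - 1 :: nat)"
          unfolding power_Suc by linarith
        then have "(3 ^ N - 1) * d + 2 * 3 ^ N * d = (3 ^ Suc N - 1) * d"
          by (simp only: flip: distrib_right)
        then show ?thesis using mspan_combos[OF v(1) G_combos] by simp
      qed
      moreover fix i assume "i \<le> Suc N"
      ultimately show "(gs(Suc N := v)) i \<in> polys m" "(gs(Suc N := v)) i \<noteq> 0"
        "total_degree ((gs(Suc N := v)) i) \<le> 3 ^ i * d"
        "(gs(Suc N := v)) i \<in> combos m s f ((3 ^ i - 1) * d)"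
        using gs v(2) by (auto simp: chain_def le_Suc_eq)
    next
      fix i j assume "i < j" "j \<le> Suc N"
      then show "\<not> (\<exists>t\<in>monoms m. lm ((gs(Suc N := v)) j) = t + lm ((gs(Suc N := v)) i))"
        using gs neg by (cases "j = Suc N") (auto simp: chain_def G_def)
    qed
    then show False using max by blast
  qed
  have pair_deg: "mdeg (lm g) + mdeg (lm g') \<le> 2 * 3 ^ N * d" if "g \<in> G" "g' \<in> G" for g g'
    using add_mono[OF G_deg[OF that(1)] G_deg[OF that(2)]] by simp
  have "p \<in> mspan m G (\<lambda>_. True)"
    unfolding h(2)
  proof (rule mspan_sum)
    fix i assume i: "i \<in> {1..s}"
    show "h i * f i \<in> mspan m G (\<lambda>_. True)"
    proof (cases "f i = 0")
      case False
      then have "f i \<in> G" using i by (simp add: G_def F_def)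
      then show ?thesis using h(1)[OF i] by (rule mspan_times)
    qed (simp add: mspan.zero)
  qed
  then have "p \<in> mspan m G (\<lambda>\<alpha>. \<alpha> \<preceq> lm p)"
    using buchberger_criterion[OF G, where e = "2 * 3 ^ N * d"] red pair_deg False by blast
  \<comment> \<open>Since the order is graded, a standard representation of \<open>p\<close>
    involves no summand of degree above that of \<open>p\<close>.\<close>
  then have "p \<in> mspan m G (\<lambda>\<mu>. mdeg \<mu> \<le> total_degree p)"
    by (rule mspan_mono) (use mdeg_lm_le[OF False] mdeg_mono in \<open>blast intro: order_trans\<close>)
  then have "p \<in> combos m s f ((3 ^ N - 1) * d + total_degree p)"
    using G_combos by (rule mspan_combos)
  moreover have "(3 ^ N - 1) * d + total_degree p \<le> \<gamma> m d (total_degree p)"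
  proof -
    \<comment> \<open>The chain has \<open>N + 1\<close> elements, which accounts for the
      \<open>- 1\<close> in the exponent of \<gamma>.\<close>
    have "(3::nat) ^ N \<le> 3 ^ (\<B> m (\<phi> d) - 1)"
      using chain_length[OF gs] by (intro power_increasing) auto
    then show ?thesis unfolding \<gamma>_def by (intro add_right_mono mult_right_mono diff_le_mono) auto
  qed
  ultimately show ?thesis using combos_mono by blast
qed

section \<open>The ideal generated by finitely many polynomials\<close>

lemma ring_mpoly_ring: "ring (mpoly_ring m :: 'a::field mpoly ring)"
proof (rule ringI)
  show "abelian_group (mpoly_ring m :: 'a mpoly ring)"
  proof (rule abelian_groupI)
    fix x :: "'a mpoly" assume "x \<in> carrier (mpoly_ring m)"
    then show "\<exists>y\<in>carrier (mpoly_ring m). y \<oplus>\<^bsub>mpoly_ring m\<^esub> x = \<zero>\<^bsub>mpoly_ring m\<^esub>"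
      unfolding carrier_mpoly_ring
      by (intro bexI[of _ "- x"]) (auto simp: mpoly_ring_def polys_uminus)
  qed (unfold carrier_mpoly_ring, auto simp: mpoly_ring_def polys_add add_ac)
  show "monoid (mpoly_ring m :: 'a mpoly ring)"
    by (rule monoidI, unfold carrier_mpoly_ring)
      (auto simp: mpoly_ring_def polys_mult mult.assoc)
qed (auto simp: mpoly_ring_def distrib_left distrib_right)

lemma ideal_combinations:
  fixes f :: "nat \<Rightarrow> 'a::field mpoly"
  assumes f: "\<And>i. i \<in> {1..s} \<Longrightarrow> f i \<in> polys m"
  shows "ideal {p. \<exists>h. (\<forall>i\<in>{1..s}. h i \<in> polys m) \<and> p = (\<Sum>i=1..s. h i * f i)} (mpoly_ring m)"
    (is "ideal ?I _")
proof -
  interpret R: ring "mpoly_ring m :: 'a mpoly ring" by (rule ring_mpoly_ring)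
  have I: "(\<Sum>i=1..s. h i * f i) \<in> ?I" if "\<And>i. i \<in> {1..s} \<Longrightarrow> h i \<in> polys m" for h
    using that by blast
  have mult: "x * a \<in> ?I" if a: "a \<in> ?I" and x: "x \<in> polys m" for a x
  proof -
    obtain h where h: "\<forall>i\<in>{1..s}. h i \<in> polys m" "a = (\<Sum>i=1..s. h i * f i)"
      using a by blast
    have "(\<Sum>i=1..s. (x * h i) * f i) \<in> ?I"
      using h(1) x by (intro I polys_mult) auto
    then show ?thesis unfolding h(2) sum_distrib_left by (simp add: mult.assoc)
  qed
  have add: "a + b \<in> ?I" if a: "a \<in> ?I" and b: "b \<in> ?I" for a b
  proof -
    obtain h k where h: "\<forall>i\<in>{1..s}. h i \<in> polys m" "a = (\<Sum>i=1..s. h i * f i)"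
      and k: "\<forall>i\<in>{1..s}. k i \<in> polys m" "b = (\<Sum>i=1..s. k i * f i)"
      using a b by blast
    have "(\<Sum>i=1..s. (h i + k i) * f i) \<in> ?I"
      using h(1) k(1) by (intro I polys_add) auto
    then show ?thesis unfolding h(2) k(2) by (simp add: distrib_right sum.distrib)
  qed
  have polys: "?I \<subseteq> polys m"
    using f by (auto intro!: polys_sum polys_mult)
  show ?thesis
  proof (rule idealI[OF ring_mpoly_ring])
    show "subgroup ?I (add_monoid (mpoly_ring m))"
    proof (rule R.add.subgroupI)
      show "?I \<noteq> {}" using I[of "\<lambda>_. 0"] by fastforce
      show "?I \<subseteq> carrier (mpoly_ring m)" using polys by (simp add: carrier_mpoly_ring)
      show "a \<oplus>\<^bsub>mpoly_ring m\<^esub> b \<in> ?I" if "a \<in> ?I" "b \<in> ?I" for a b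
        using add[OF that] by (simp add: mpoly_ring_def)
      show "\<ominus>\<^bsub>mpoly_ring m\<^esub> a \<in> ?I" if a: "a \<in> ?I" for a
      proof -
        have "a \<in> polys m" using a polys by blast
        \<comment> \<open>Uniqueness of inverses identifies the negation of the record with that of
          the type class; the latter is multiplication by \<open>- 1\<close>, under which the set is
          closed.\<close>
        then have "\<ominus>\<^bsub>mpoly_ring m\<^esub> a = - a"
          by (intro R.minus_equality)
            (unfold carrier_mpoly_ring, auto simp: mpoly_ring_def polys_uminus)
        also have "- a = - 1 * a" by simp
        finally show ?thesis using mult[OF a, of "- 1"] by (simp add: polys_uminus)
      qed
    qed
  next
    fix a x :: "'a mpoly" assume a: "a \<in> ?I" and "x \<in> carrier (mpoly_ring m)"
    then have "x * a \<in> ?I" using mult carrier_mpoly_ring by blast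
    then show "x \<otimes>\<^bsub>mpoly_ring m\<^esub> a \<in> ?I" "a \<otimes>\<^bsub>mpoly_ring m\<^esub> x \<in> ?I"
      by (simp_all add: mpoly_ring_def mult.commute)
  qed
qed

text \<open>One inclusion is minimality of the generated ideal, the other its closure under the
  operations, applied along an induction over finite index sets.\<close>

lemma genideal_eq_combinations:
  fixes f :: "nat \<Rightarrow> 'a::field mpoly"
  assumes f: "\<And>i. i \<in> {1..s} \<Longrightarrow> f i \<in> polys m"
  shows "Idl\<^bsub>mpoly_ring m\<^esub> (f ` {1..s}) =
    {p. \<exists>h. (\<forall>i\<in>{1..s}. h i \<in> polys m) \<and> p = (\<Sum>i=1..s. h i * f i)}"
    (is "?L = ?I")
proof
  interpret R: ring "mpoly_ring m :: 'a mpoly ring" by (rule ring_mpoly_ring)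
  have "f i \<in> ?I" if "i \<in> {1..s}" for i
    using generator_in_combos[OF that, of f m 0] unfolding combos_def by blast
  then show "?L \<subseteq> ?I"
    by (intro R.genideal_minimal ideal_combinations f) auto
  have fc: "f ` {1..s} \<subseteq> carrier (mpoly_ring m)"
    using f by (auto simp: carrier_mpoly_ring)
  interpret I: ideal ?L "mpoly_ring m" by (rule R.genideal_ideal[OF fc])
  have "(\<Sum>i=1..s. h i * f i) \<in> ?L" if h: "\<And>i. i \<in> {1..s} \<Longrightarrow> h i \<in> polys m" for h
  proof -
    have "(\<Sum>i\<in>A. h i * f i) \<in> ?L" if "finite A" "A \<subseteq> {1..s}" for A
      using that
    proof (induction A rule: finite_induct)
      case empty
      show ?case using I.zero_closed by (simp add: mpoly_ring_def)
    next
      case (insert i A)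
      then have i: "f i \<in> ?L" "h i \<in> carrier (mpoly_ring m)"
        using R.genideal_self[OF fc] h by (auto simp: carrier_mpoly_ring)
      have "h i \<otimes>\<^bsub>mpoly_ring m\<^esub> f i \<in> ?L" by (rule I.I_l_closed[OF i])
      then have "(h i \<otimes>\<^bsub>mpoly_ring m\<^esub> f i) \<oplus>\<^bsub>mpoly_ring m\<^esub> (\<Sum>i\<in>A. h i * f i) \<in> ?L"
        using insert by (intro I.a_closed) auto
      then show ?case using insert by (simp add: mpoly_ring_def)
    qed
    then show ?thesis by blast
  qed
  then show "?I \<subseteq> ?L" by blast
qed

lemma mem_genideal_iff_combos:
  assumes "\<And>i. i \<in> {1..s} \<Longrightarrow> f i \<in> polys m"
  shows "g \<in> Idl\<^bsub>mpoly_ring m\<^esub> (f ` {1..s}) \<longleftrightarrow> (\<exists>E. g \<in> combos m s f E)"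
proof
  assume "g \<in> Idl\<^bsub>mpoly_ring m\<^esub> (f ` {1..s})"
  then obtain h where h: "\<forall>i\<in>{1..s}. h i \<in> polys m" "g = (\<Sum>i=1..s. h i * f i)"
    using genideal_eq_combinations[of s f m] assms by auto
  \<comment> \<open>The sum of all cofactor degrees serves as a crude common bound, valid also for
    \<open>s = 0\<close>.\<close>
  have "g \<in> combos m s f (\<Sum>i=1..s. total_degree (h i))"
    unfolding h(2) using h(1) by (intro combosI) (auto intro: member_le_sum)
  then show "\<exists>E. g \<in> combos m s f E" by blast
next
  assume "\<exists>E. g \<in> combos m s f E"
  then show "g \<in> Idl\<^bsub>mpoly_ring m\<^esub> (f ` {1..s})"
    using genideal_eq_combinations[of s f m] assms unfolding combos_def by blast
qed

theorem corollary4p5: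
  fixes m d s :: nat
    and g :: "'a::field mpoly"
    and f :: "nat \<Rightarrow> 'a mpoly"
  assumes "m \<ge> 1" and "d \<ge> 1"
    and "g \<in> carrier (mpoly_ring m)"
    and "\<And>i. i \<in> {1..s} \<Longrightarrow> f i \<in> carrier (mpoly_ring m)"
    and "\<And>i. i \<in> {1..s} \<Longrightarrow> total_degree (f i) \<le> d"
  shows "g \<in> Idl\<^bsub>mpoly_ring m\<^esub> (f ` {1..s}) \<longleftrightarrow>
    (\<exists>h. (\<forall>i\<in>{1..s}. h i \<in> carrier (mpoly_ring m)) \<and>
         g = (\<Sum>i=1..s. h i * f i) \<and>
         (\<forall>i\<in>{1..s}. total_degree (h i) \<le> \<gamma> m d (total_degree g)))"
proof -
  have "g \<in> Idl\<^bsub>mpoly_ring m\<^esub> (f ` {1..s}) \<longleftrightarrow> (\<exists>E. g \<in> combos m s f E)"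
    using assms(4) by (intro mem_genideal_iff_combos) (simp add: carrier_mpoly_ring)
  also have "\<dots> \<longleftrightarrow> g \<in> combos m s f (\<gamma> m d (total_degree g))"
    using combos_effective[of m s f d g] assms by (auto simp: carrier_mpoly_ring)
  finally show ?thesis unfolding combos_def carrier_mpoly_ring by blast
qed

end
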